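(* Let $\mathcal G$ be a hereditary class of digraphs, and let $c\in[0,1]$. Suppose that every digraph $D\in\mathcal G$ on $n$ vertices has a quasi-kernel $Q$ with $$|Q|\ge n^c$$ (for every $n$). Then every digraph $D\in\mathcal G$ on $n$ vertices has a quasi-kernel $Q$ such that $$|N_D^+[Q]|\ge n^{(1+c)/2}.$$
   Context: All digraphs are finite and loopless (pairs of opposite arcs are allowed). A class of digraphs is hereditary if it is closed under taking induced subdigraphs. A set of vertices is independent if there is no arc between any two of its vertices. A quasi-kernel of a digraph $D$ is an independent set $Q\subseteq V(D)$ such that every vertex of $D$ is reachable from some vertex of $Q$ by a directed path of length at most $2$ (length $0$ allowed). For $X\subseteq V(D)$, the closed out-neighborhood is $N_D^+[X]=X\cup\{u\in V(D)\setminus X : xu\in A(D)\text{ for some }x\in X\}$, where $A(D)$ is the arc set of $D$. *)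

theory Defs
  imports Complex_Main "Graph_Theory.Graph_Theory"
begin

text \<open>
  The locale \<^locale>\<open>digraph\<close> describes exactly the finite digraphs without loops and
  parallel arcs; opposite arcs are allowed, and so is the digraph without vertices.
\<close>

definition hereditary :: "('a, 'b) pre_digraph set \<Rightarrow> bool" where
  "hereditary \<G> \<longleftrightarrow> (\<forall>D\<in>\<G>. \<forall>H. induced_subgraph H D \<longrightarrow> H \<in> \<G>)"

definition independent_verts :: "('a, 'b) pre_digraph \<Rightarrow> 'a set \<Rightarrow> bool" where
  "independent_verts D Q \<longleftrightarrow> Q \<subseteq> verts D \<and> (\<forall>u\<in>Q. \<forall>v\<in>Q. \<not> u \<rightarrow>\<^bsub>D\<^esub> v)"

text \<open>
  A path is represented by its list of arcs, so the length of that list is the length of the path.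
\<close>

definition quasi_kernel :: "('a, 'b) pre_digraph \<Rightarrow> 'a set \<Rightarrow> bool" where
  "quasi_kernel D Q \<longleftrightarrow> independent_verts D Q \<and>
     (\<forall>v\<in>verts D. \<exists>q\<in>Q. \<exists>p. pre_digraph.apath D q p v \<and> length p \<le> 2)"

definition closed_out_nbhd :: "('a, 'b) pre_digraph \<Rightarrow> 'a set \<Rightarrow> 'a set" where
  "closed_out_nbhd D X = X \<union> {u \<in> verts D - X. \<exists>x\<in>X. x \<rightarrow>\<^bsub>D\<^esub> u}"

end

theory Submission
  imports Defs
begin

text \<open>
  Strong induction on the number \<open>n\<close> of vertices. Take a quasi-kernel \<open>Q\<^sub>1\<close> with at least \<open>n\<^sup>c\<close>
  vertices. If its closed out-neighborhood \<open>N\<close> is too small, delete \<open>N\<close>, choose a quasi-kernel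
  \<open>Q\<^sub>2\<close> of the rest by induction, and add to \<open>Q\<^sub>2\<close> the vertices of \<open>Q\<^sub>1\<close> that it does not dominate.
  The result is a quasi-kernel of the whole digraph, and its closed out-neighborhood contains
  both \<open>Q\<^sub>1\<close> and the closed out-neighborhood of \<open>Q\<^sub>2\<close> in the rest, which are disjoint. For
  \<open>a = (1 + c) / 2\<close> and \<open>|N| \<le> n\<^sup>a\<close>, concavity of \<open>x\<^sup>a\<close> gives
  \<open>n\<^sup>c + (n - |N|)\<^sup>a \<ge> n\<^sup>a\<close>, without any loss of a constant factor.
\<close>

text \<open>This trades arc lists for adjacency, so that quasi-kernels can be handled by first-order
  reasoning about arcs alone.\<close>

lemma (in digraph) ex_short_apath_iff:
  assumes "q \<in> verts G"
  shows "(\<exists>p. apath q p v \<and> length p \<le> 2) \<longleftrightarrow>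
    v = q \<or> q \<rightarrow>\<^bsub>G\<^esub> v \<or> (\<exists>w. q \<rightarrow>\<^bsub>G\<^esub> w \<and> w \<rightarrow>\<^bsub>G\<^esub> v)" (is "?L \<longleftrightarrow> ?R")
proof
  assume ?L
  then obtain p where p: "apath q p v" "length p \<le> 2" by blast
  consider "p = []" | e where "p = [e]" | e f where "p = [e, f]"
    using p(2) by (cases p; cases "tl p") auto
  then show ?R
    using p(1) by cases (use in_arcs_imp_in_arcs_ends in \<open>fastforce simp: apath_simps\<close>)+
next
  have arc: "\<exists>e \<in> arcs G. tail G e = x \<and> head G e = y" if "x \<rightarrow>\<^bsub>G\<^esub> y" for x y
    using that by (auto simp: arcs_ends_def arc_to_ends_def)
  assume ?R
  \<comment> \<open>An \<open>apath\<close> repeats no vertex, so a closed walk \<open>q\<close>,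
    \<open>w\<close>, \<open>q\<close> is not one; splitting off \<open>v = q\<close> lets the empty
    path cover that case.\<close>
  then consider "v = q" | "v \<noteq> q" "q \<rightarrow>\<^bsub>G\<^esub> v" | w where "v \<noteq> q" "q \<rightarrow>\<^bsub>G\<^esub> w" "w \<rightarrow>\<^bsub>G\<^esub> v"
    by blast
  then show ?L
  proof cases
    case 1
    then show ?thesis using assms by (intro exI[of _ "[]"]) (simp add: apath_Nil_iff)
  next
    case 2
    then obtain e where "e \<in> arcs G" "tail G e = q" "head G e = v" using arc by blast
    then show ?thesis using 2 by (intro exI[of _ "[e]"]) (auto simp: apath_simps)
  next
    case 3
    then obtain e f where "e \<in> arcs G" "tail G e = q" "head G e = w"
      "f \<in> arcs G" "tail G f = w" "head G f = v" using arc by meson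
    then show ?thesis
      using 3 adj_not_same by (intro exI[of _ "[e, f]"]) (auto simp: apath_simps)
  qed
qed

lemma (in digraph) quasi_kernel_iff:
  "quasi_kernel G Q \<longleftrightarrow> independent_verts G Q \<and>
     (\<forall>v\<in>verts G. \<exists>q\<in>Q. v = q \<or> q \<rightarrow>\<^bsub>G\<^esub> v \<or> (\<exists>w. q \<rightarrow>\<^bsub>G\<^esub> w \<and> w \<rightarrow>\<^bsub>G\<^esub> v))"
\<comment> \<open>The path criterion applies only to vertices \<open>q\<close> of \<open>G\<close>.
  If \<open>Q\<close> leaves the vertex set, independence fails and both sides are false.\<close>
proof (cases "Q \<subseteq> verts G")
  case True
  then show ?thesis
    unfolding quasi_kernel_def using ex_short_apath_iff by (meson subsetD)
qed (simp add: quasi_kernel_def independent_verts_def)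

lemma dominates_induce_subgraph_iff:
  "u \<rightarrow>\<^bsub>D \<restriction> S\<^esub> v \<longleftrightarrow> u \<in> S \<and> v \<in> S \<and> u \<rightarrow>\<^bsub>D\<^esub> v"
  by (auto simp: arcs_ends_def arc_to_ends_def)

text \<open>No arc runs from \<open>I\<close> to \<open>K\<close>, since \<open>K\<close> avoids the
  closed out-neighborhood of \<open>I\<close>; arcs from \<open>K\<close> to \<open>I\<close> vanish
  once the vertices dominated by \<open>K\<close> are dropped from \<open>I\<close>. A dropped
  vertex has an in-neighbor in \<open>K\<close>, so it stays in the closed out-neighborhood of
  \<open>Q\<close>.\<close>

lemma quasi_kernel_extend:
  fixes D :: "('a, 'b) pre_digraph"
  assumes "digraph D" and I: "independent_verts D I"
    and D': "D' = D \<restriction> (verts D - closed_out_nbhd D I)" and K: "quasi_kernel D' K"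
  defines "Q \<equiv> K \<union> (I - closed_out_nbhd D K)"
  shows "quasi_kernel D Q" and "I \<union> closed_out_nbhd D' K \<subseteq> closed_out_nbhd D Q"
proof -
  interpret digraph D by fact
  have ind: "induced_subgraph D' D" unfolding D' by (intro induced_induce) auto
  interpret D': digraph D' using ind by (rule digraphI_induced)
  have vD': "verts D' = verts D - closed_out_nbhd D I" by (simp add: D')
  have domD: "u \<rightarrow>\<^bsub>D\<^esub> v" if "u \<rightarrow>\<^bsub>D'\<^esub> v" for u v
    using that by (simp add: D' dominates_induce_subgraph_iff)
  have KD': "independent_verts D' K"
    "\<forall>v\<in>verts D'. \<exists>q\<in>K. v = q \<or> q \<rightarrow>\<^bsub>D'\<^esub> v \<or> (\<exists>w. q \<rightarrow>\<^bsub>D'\<^esub> w \<and> w \<rightarrow>\<^bsub>D'\<^esub> v)"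
    using K unfolding D'.quasi_kernel_iff by blast+
  have Kind: "independent_verts D K"
    using KD'(1) by (auto simp: independent_verts_def D' dominates_induce_subgraph_iff)
  have Kdom: "\<exists>q\<in>K. v = q \<or> q \<rightarrow>\<^bsub>D\<^esub> v \<or> (\<exists>w. q \<rightarrow>\<^bsub>D\<^esub> w \<and> w \<rightarrow>\<^bsub>D\<^esub> v)"
    if "v \<in> verts D'" for v
    using KD'(2) that domD by meson
  have IV: "I \<subseteq> verts D" and KV: "K \<subseteq> verts D"
    using I Kind by (auto simp: independent_verts_def)
  have KN: "K \<inter> closed_out_nbhd D I = {}"
    using K by (auto simp: quasi_kernel_def independent_verts_def vD')
  have no_arc: "\<not> u \<rightarrow>\<^bsub>D\<^esub> v" if "u \<in> I" "v \<in> K" for u v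
    using that KN KV by (auto simp: closed_out_nbhd_def)
  have no_arc': "\<not> u \<rightarrow>\<^bsub>D\<^esub> v" if "u \<in> K" "v \<in> I - closed_out_nbhd D K" for u v
    using that IV by (auto simp: closed_out_nbhd_def)
  have "independent_verts D Q"
    using I Kind no_arc no_arc' unfolding independent_verts_def Q_def by blast
  moreover have "\<exists>q\<in>Q. v = q \<or> q \<rightarrow>\<^bsub>D\<^esub> v \<or> (\<exists>w. q \<rightarrow>\<^bsub>D\<^esub> w \<and> w \<rightarrow>\<^bsub>D\<^esub> v)"
    if v: "v \<in> verts D" for v
  proof (cases "v \<in> verts D'")
    case True
    then show ?thesis using Kdom unfolding Q_def by blast
  next
    case False
    then obtain x where x: "x \<in> I" "v = x \<or> x \<rightarrow>\<^bsub>D\<^esub> v"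
      using v by (auto simp: vD' closed_out_nbhd_def)
    \<comment> \<open>The vertex \<open>v\<close> is at most one arc away from \<open>x\<close>, and
      \<open>x\<close> is at most one arc away from \<open>Q\<close>, which gives length at most
      2.\<close>
    have "x \<in> Q \<or> (\<exists>q\<in>K. q \<rightarrow>\<^bsub>D\<^esub> x)"
      using x(1) by (auto simp: Q_def closed_out_nbhd_def)
    then show ?thesis using x(2) unfolding Q_def by blast
  qed
  ultimately show "quasi_kernel D Q" unfolding quasi_kernel_iff by blast
  show "I \<union> closed_out_nbhd D' K \<subseteq> closed_out_nbhd D Q"
    using IV domD by (auto simp: closed_out_nbhd_def Q_def vD')
qed

text \<open>For \<open>t = y / x\<close> in the unit interval, \<open>a \<le> 1\<close> gives
  \<open>(1 - t) powr a \<ge> 1 - t\<close>. Scaling by \<open>x powr a\<close> leaves a loss of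
  \<open>x powr a * y / x\<close>, which \<open>y \<le> x powr a\<close> bounds by
  \<open>x powr (2 * a - 1)\<close>.\<close>

lemma powr_diff_ge:
  fixes x y a :: real
  assumes "0 < x" "0 \<le> y" "y \<le> x" "y \<le> x powr a" "a \<le> 1"
  shows "x powr a \<le> x powr (2 * a - 1) + (x - y) powr a"
proof -
  have "1 - y / x = (1 - y / x) powr 1"
    using assms by (simp add: field_simps)
  also have "\<dots> \<le> (1 - y / x) powr a"
    using assms by (intro powr_mono') (auto simp: field_simps)
  finally have "x powr a * (1 - y / x) \<le> x powr a * (1 - y / x) powr a"
    by (intro mult_left_mono) auto
  also have "\<dots> = (x - y) powr a"
    using assms by (simp flip: powr_mult add: right_diff_distrib)
  finally have "x powr a - x powr a * y / x \<le> (x - y) powr a"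
    by (simp add: algebra_simps)
  moreover have "x powr a * y / x \<le> x powr a * x powr a / x"
    using assms by (intro divide_right_mono mult_left_mono) auto
  moreover have "x powr a * x powr a / x = x powr (2 * a - 1)"
    using assms by (simp add: powr_diff flip: powr_add)
  ultimately show ?thesis by linarith
qed

theorem theorem6p1:
  fixes \<G> :: "('a, 'b) pre_digraph set" and c :: real
  assumes "\<forall>D\<in>\<G>. digraph D"
    and "hereditary \<G>"
    and "0 \<le> c" and "c \<le> 1"
    and "\<forall>D\<in>\<G>. \<exists>Q. quasi_kernel D Q \<and> real (card Q) \<ge> real (card (verts D)) powr c"
  shows "\<forall>D\<in>\<G>. \<exists>Q. quasi_kernel D Q \<and>
    real (card (closed_out_nbhd D Q)) \<ge> real (card (verts D)) powr ((1 + c) / 2)"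
proof
  fix D :: "('a, 'b) pre_digraph"
  assume "D \<in> \<G>"
  define a where "a = (1 + c) / 2"
  \<comment> \<open>The exponent \<open>(1 + c) / 2\<close> is the one for which the loss in
    \<open>powr_diff_ge\<close> equals the guaranteed size \<open>n powr c\<close> of
    \<open>I\<close>.\<close>
  have a: "2 * a - 1 = c" "a \<le> 1" using \<open>c \<le> 1\<close> by (auto simp: a_def field_simps)
  show "\<exists>Q. quasi_kernel D Q \<and>
    real (card (closed_out_nbhd D Q)) \<ge> real (card (verts D)) powr ((1 + c) / 2)"
    unfolding a_def[symmetric] using \<open>D \<in> \<G>\<close>
  proof (induction "card (verts D)" arbitrary: D rule: less_induct)
    case less
    interpret digraph D using assms(1) less.prems by blast
    define n where "n = card (verts D)"
    obtain I where I: "quasi_kernel D I" "real (card I) \<ge> real n powr c"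
      using assms(5) less.prems n_def by blast
    have Iind: "independent_verts D I" using I(1) by (simp add: quasi_kernel_def)
    define N where "N = closed_out_nbhd D I"
    have NV: "N \<subseteq> verts D" using Iind by (auto simp: N_def closed_out_nbhd_def independent_verts_def)
    have finN: "finite N" using NV by (rule finite_subset) simp
    have IN: "I \<subseteq> N" by (auto simp: N_def closed_out_nbhd_def)
    show ?case
    \<comment> \<open>For \<open>n = 0\<close> the bound is trivial because
      \<open>0 powr a = 0\<close>.\<close>
    proof (cases "n = 0 \<or> real (card N) \<ge> real n powr a")
      case True
      then show ?thesis using I(1) by (auto simp: N_def n_def)
    next
      case False
      then have n: "n > 0" and small: "real (card N) \<le> real n powr a" by auto
      define D' where "D' = D \<restriction> (verts D - N)"
      have ind: "induced_subgraph D' D" unfolding D'_def by (intro induced_induce) auto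
      then have D': "D' \<in> \<G>" using assms(2) less.prems unfolding hereditary_def by blast
      \<comment> \<open>A nonempty \<open>I\<close> makes \<open>N\<close> nonempty, so
        \<open>D'\<close> has fewer vertices than \<open>D\<close> and the induction hypothesis
        applies.\<close>
      have "card I > 0" using I(2) n by (smt (verit) of_nat_0_less_iff powr_gt_zero)
      then have "card N > 0" using card_mono[OF finN IN] by linarith
      have card_le: "card N \<le> n" unfolding n_def using NV by (simp add: card_mono)
      have card_D': "card (verts D') = n - card N"
        using NV finN by (simp add: D'_def n_def card_Diff_subset)
      have "card (verts D') < card (verts D)"
        using card_D' \<open>card N > 0\<close> n n_def by linarith
      then obtain K where K: "quasi_kernel D' K"
        "real (card (closed_out_nbhd D' K)) \<ge> real (card (verts D')) powr a"
        using less.hyps D' by blast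
      define Q where "Q = K \<union> (I - closed_out_nbhd D K)"
      have Q: "quasi_kernel D Q" "I \<union> closed_out_nbhd D' K \<subseteq> closed_out_nbhd D Q"
        unfolding Q_def
        using quasi_kernel_extend[OF digraph_axioms Iind D'_def[unfolded N_def] K(1)] by auto
      have NQ: "closed_out_nbhd D Q \<subseteq> verts D"
        using Q(1) by (auto simp: quasi_kernel_def independent_verts_def closed_out_nbhd_def)
      have fin: "finite (closed_out_nbhd D Q)" using NQ by (rule finite_subset) simp
      have "closed_out_nbhd D' K \<subseteq> verts D - N"
        using K(1) by (auto simp: quasi_kernel_def independent_verts_def closed_out_nbhd_def D'_def)
      then have "card (I \<union> closed_out_nbhd D' K) = card I + card (closed_out_nbhd D' K)"
        using IN Q(2) fin by (intro card_Un_disjoint) (auto intro: finite_subset)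
      then have "card I + card (closed_out_nbhd D' K) \<le> card (closed_out_nbhd D Q)"
        using card_mono[OF fin Q(2)] by simp
      moreover have "real n powr a \<le> real n powr c + (real n - real (card N)) powr a"
        using powr_diff_ge[of "real n" "real (card N)" a] n small card_le a by simp
      ultimately have "real (card (closed_out_nbhd D Q)) \<ge> real n powr a"
        using I(2) K(2) card_D' card_le by (simp add: of_nat_diff)
      then show ?thesis using Q(1) n_def by blast
    qed
  qed
qed

end
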